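(* Let $(R_n)_{n\in\mathbb Z}$ be real numbers with $R_n\ge 0$ for all $n$. Let $N\ge 0$ be an integer and let $C_i,P_i,Q_i$ ($i=1,\dots,N$) be real numbers with $$P_N\ge P_{N-1}\ge\dots\ge P_1\ge 0,\qquad Q_N\ge Q_{N-1}\ge\dots\ge Q_1\ge 0 .$$ Put $\Omega_{i,n}=\min(Q_i,R_{n-1})$ for $n\in\mathbb Z$, and for $l,m,n\in\mathbb Z$ $$\eta_i=\eta_i(l,m,n)=C_i+lP_i-mQ_i-\sum_{0}^{n}\Omega_{i,d}.$$ Define functions $T^{(k)}_{l,m,n}$ on $\mathbb Z^3$ recursively by $T^{(0)}_{l,m,n}=0$ and $$T^{(k)}_{l,m,n}=\max\big(T^{(k-1)}_{l,m,n},\;2\eta_k(l,m,n)+T^{(k-1)}_{l-1,m+1,n}\big)\qquad(1\le k\le N).$$ Then $T=T^{(N)}$ solves the non-autonomous ultradiscrete KP equation: for all $l,m,n\in\mathbb Z$, $$T_{l,m+1,n}+T_{l+1,m,n+1}=\max\big(T_{l+1,m,n}+T_{l,m+1,n+1}-2R_n,\;T_{l,m,n+1}+T_{l+1,m+1,n}\big).$$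
   Context: The symbol $\sum_{i}^{j}\Omega_{k,d}$ (for integers $i,j$) denotes the signed sum: $\sum_{d=i+1}^{j}\Omega_{k,d}$ if $i<j$; $0$ if $i=j$; $-\sum_{d=j+1}^{i}\Omega_{k,d}$ if $i>j$. *)

theory Defs
  imports Complex_Main
begin

definition signed_sum :: "int \<Rightarrow> int \<Rightarrow> (int \<Rightarrow> real) \<Rightarrow> real" where
  "signed_sum i j f =
    (if i < j then (\<Sum>d = i + 1..j. f d)
     else if i = j then 0
     else - (\<Sum>d = j + 1..i. f d))"

text \<open>
  The families \<open>C\<close>, \<open>P\<close>, \<open>Q\<close> are indexed from \<open>1\<close>; their values at \<open>0\<close> are never used.
\<close>

definition Omega :: "(nat \<Rightarrow> real) \<Rightarrow> (int \<Rightarrow> real) \<Rightarrow> nat \<Rightarrow> int \<Rightarrow> real" where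
  "Omega Q R i n = min (Q i) (R (n - 1))"

definition eta ::
  "(nat \<Rightarrow> real) \<Rightarrow> (nat \<Rightarrow> real) \<Rightarrow> (nat \<Rightarrow> real) \<Rightarrow> (int \<Rightarrow> real) \<Rightarrow>
   nat \<Rightarrow> int \<Rightarrow> int \<Rightarrow> int \<Rightarrow> real" where
  "eta C P Q R i l m n =
    C i + of_int l * P i - of_int m * Q i - signed_sum 0 n (Omega Q R i)"

primrec T ::
  "(nat \<Rightarrow> real) \<Rightarrow> (nat \<Rightarrow> real) \<Rightarrow> (nat \<Rightarrow> real) \<Rightarrow> (int \<Rightarrow> real) \<Rightarrow>
   nat \<Rightarrow> int \<Rightarrow> int \<Rightarrow> int \<Rightarrow> real" where
  "T C P Q R 0 = (\<lambda>l m n. 0)"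
| "T C P Q R (Suc k) = (\<lambda>l m n.
     max (T C P Q R k l m n)
         (2 * eta C P Q R (Suc k) l m n + T C P Q R k (l - 1) (m + 1) n))"

definition solves_nonautonomous_uKP ::
  "(int \<Rightarrow> real) \<Rightarrow> (int \<Rightarrow> int \<Rightarrow> int \<Rightarrow> real) \<Rightarrow> bool" where
  "solves_nonautonomous_uKP R \<tau> \<longleftrightarrow>
    (\<forall>l m n.
      \<tau> l (m + 1) n + \<tau> (l + 1) m (n + 1) =
      max (\<tau> (l + 1) m n + \<tau> l (m + 1) (n + 1) - 2 * R n)
          (\<tau> l m (n + 1) + \<tau> (l + 1) (m + 1) n))"

end

theory Submission
  imports Defs "HOL-Library.Function_Algebras"
begin

text \<open>
  Unfolding the recursion, \<open>T\<close> is the maximum over subsets \<open>S\<close> of \<open>{1..N}\<close> of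
  \<open>\<Sum>i\<in>S. x i - \<Sum>i<j in S. a i\<close>, where \<open>x = 2\<eta>\<close> and \<open>a = 2(P + Q)\<close>; moving in the lattice
  translates \<open>x\<close>. Along directions \<open>w\<close>, \<open>s\<close> such that \<open>w\<close>, \<open>s\<close>, \<open>a - w\<close>, \<open>a - s\<close> are nonnegative
  and nondecreasing in the index, the mixed second difference of this maximum lies between \<open>0\<close> and
  \<open>max w\<close>; both bounds follow from one simultaneous induction. The equation itself is proved by
  induction on the number of solitons. Expanding both sides in powers of the last soliton, the terms
  of degree 0 and 2 are instances of the induction hypothesis, and in degree 1 the second difference
  bounds show that one and the same term dominates on both sides, provided \<open>R n \<le> Q N\<close>. If
  \<open>R n > Q N\<close>, then all \<open>\<Omega> i\<close> equal \<open>Q i\<close> and a single second difference bound suffices.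
\<close>

section \<open>Subset maxima and admissible shift directions\<close>

fun smax :: "(nat \<Rightarrow> real) \<Rightarrow> nat \<Rightarrow> (nat \<Rightarrow> real) \<Rightarrow> real" where
  "smax a 0 x = 0"
| "smax a (Suc k) x = max (smax a k x) (x (Suc k) + smax a k (x - a))"

text \<open>The condition is symmetric under exchanging \<open>w\<close> and \<open>a - w\<close>;
  this absorbs the shift by \<open>a\<close> in the recursion of \<open>smax\<close>.\<close>

definition admissible :: "nat \<Rightarrow> (nat \<Rightarrow> real) \<Rightarrow> (nat \<Rightarrow> real) \<Rightarrow> bool" where
  "admissible n a w \<longleftrightarrow> (\<forall>i\<in>{1..n}. 0 \<le> w i \<and> w i \<le> a i) \<and>
     mono_on {1..n} w \<and> mono_on {1..n} (a - w)"

lemma max_add_max_le: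
  fixes a b c d e :: real
  assumes "a + c \<le> e" "a + d \<le> e" "b + c \<le> e" "b + d \<le> e"
  shows "max a b + max c d \<le> e"
  using assms by (auto simp: max_def)

text \<open>
  The step from \<open>k\<close> to \<open>k + 1\<close> solitons: the first four assumptions make \<open>f + g\<close> the dominant
  term of degree 1 in \<open>x\<close>, the last two are the induction hypotheses in degrees 0 and 2.
\<close>

lemma max_exchange:
  fixes d e f g h i j k l m p q r x :: real
  assumes "d + e \<le> f + g + (p + q - r)"
    and "h + i \<le> f + g + (p + q + r)"
    and "j + k \<le> f + g + p"
    and "l + m \<le> f + g + (q - r)"
    and "g + d = max (h + f - r) (l + j)"
    and "e + f = max (g + i - r) (k + m)"
  shows "max g (x - q + e) + max d (x + p - r + f) =
    max (max h (x + p + g) + max f (x - q - r + i) - r)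
        (max l (x - r + k) + max j (x + p - q + m))"
proof (rule antisym)
  show "max g (x - q + e) + max d (x + p - r + f) \<le>
      max (max h (x + p + g) + max f (x - q - r + i) - r)
        (max l (x - r + k) + max j (x + p - q + m))"
    using assms unfolding max_def by (smt (verit))
  show "max (max h (x + p + g) + max f (x - q - r + i) - r)
        (max l (x - r + k) + max j (x + p - q + m)) \<le>
      max g (x - q + e) + max d (x + p - r + f)"
    using assms unfolding max_def by (smt (verit))
qed

lemma smax_cong:
  assumes "\<And>i. i \<in> {1..k} \<Longrightarrow> x i = y i"
  shows "smax a k x = smax a k y"
  using assms
proof (induction k arbitrary: x y)
  case (Suc k)
  have "smax a k x = smax a k y" "smax a k (x - a) = smax a k (y - a)"
    by (rule Suc.IH; use Suc.prems in simp)+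
  with Suc.prems show ?case by simp
qed simp

lemma admissible_mono: "admissible n a w \<Longrightarrow> k \<le> n \<Longrightarrow> admissible k a w"
  by (simp add: admissible_def mono_on_def)

lemma admissible_diff: "admissible n a w \<Longrightarrow> admissible n a (a - w)"
  by (simp add: admissible_def mono_on_def)

lemma admissible_self:
  assumes "admissible n a w"
  shows "admissible n a a"
proof -
  have "0 \<le> a i" if "i \<in> {1..n}" for i
    using assms that unfolding admissible_def by (meson order_trans)
  moreover have "a i \<le> a j" if "i \<in> {1..n}" "j \<in> {1..n}" "i \<le> j" for i j
  proof -
    have "w i \<le> w j" "(a - w) i \<le> (a - w) j"
      using assms that unfolding admissible_def mono_on_def by blast+
    then show ?thesis by simp
  qed
  ultimately show ?thesis
    by (simp add: admissible_def mono_on_def)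
qed

lemma admissible_le_last:
  assumes "admissible (Suc k) a w" "i \<in> {1..k}"
  shows "w i \<le> w (Suc k)"
  using assms by (simp add: admissible_def mono_on_def)

section \<open>Mixed second differences\<close>

text \<open>The two bounds feed each other: complementing a direction turns the square for one bound
  into a square for the other.\<close>

lemma smax_second_difference:
  assumes "admissible n a w" "admissible n a s"
  shows smax_supermodular: "smax a n (v + w) + smax a n (v + s) \<le> smax a n (v + w + s) + smax a n v"
    and smax_submodular_upto: "\<And>W. 0 \<le> W \<Longrightarrow> \<forall>i\<in>{1..n}. w i \<le> W \<Longrightarrow>
      smax a n (v + w + s) + smax a n v \<le> smax a n (v + w) + smax a n (v + s) + W"
proof -
  \<comment> \<open>\<open>0 <= W\<close> settles \<open>n = 0\<close>, where the bound on
    \<open>w\<close> is vacuous.\<close>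
  have "smax a n (v + w) + smax a n (v + s) \<le> smax a n (v + w + s) + smax a n v \<and>
    (\<forall>W. 0 \<le> W \<longrightarrow> (\<forall>i\<in>{1..n}. w i \<le> W) \<longrightarrow>
      smax a n (v + w + s) + smax a n v \<le> smax a n (v + w) + smax a n (v + s) + W)"
    using assms
  proof (induction n arbitrary: v w s)
    case (Suc n)
    let ?k = "Suc n"
    have lower: "smax a n (v + w) + smax a n (v + s) \<le> smax a n (v + w + s) + smax a n v"
      if "admissible ?k a w" "admissible ?k a s" for v w s
      using Suc.IH[of w s v] admissible_mono[of ?k a _ n] that by (metis le_SucI order_refl)
    \<comment> \<open>By monotonicity \<open>w ?k\<close> bounds all earlier entries, so
      \<open>W = w ?k\<close> is allowed; this is exactly the change of the head term under
      \<open>w\<close>.\<close>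
    have upper: "smax a n (v + w + s) + smax a n v \<le> smax a n (v + w) + smax a n (v + s) + W"
      if "admissible ?k a w" "admissible ?k a s" "w ?k \<le> W" for v w s W
    proof -
      have "\<forall>i\<in>{1..n}. w i \<le> W"
        using admissible_le_last[OF that(1)] that(3) by fastforce
      moreover have "0 \<le> W"
        using that(1,3) by (auto simp: admissible_def dest!: bspec[where x = ?k])
      ultimately show ?thesis
        using Suc.IH[of w s v] admissible_mono[of ?k a _ n] that by (metis le_SucI order_refl)
    qed
    note w = Suc.prems(1) and s = Suc.prems(2)
    note w' = admissible_diff[OF w] and s' = admissible_diff[OF s] and a = admissible_self[OF w]
    have ge: "smax a n y \<le> smax a ?k y" "y ?k + smax a n (y - a) \<le> smax a ?k y" for y
      by simp_all
    have "smax a ?k (v + w) + smax a ?k (v + s) \<le> smax a ?k (v + w + s) + smax a ?k v"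
      unfolding smax.simps(2)[of a n "v + w"] smax.simps(2)[of a n "v + s"]
    proof (rule max_add_max_le)
      show "smax a n (v + w) + smax a n (v + s) \<le> smax a ?k (v + w + s) + smax a ?k v"
        using lower[OF w s, of v] ge(1)[of "v + w + s"] ge(1)[of v] by linarith
      \<comment> \<open>From the base \<open>v + s - a\<close>, the direction \<open>a - s\<close>
        leads to \<open>v\<close>; the error \<open>w ?k\<close> enters the head of
        \<open>v + w + s\<close>.\<close>
      show "smax a n (v + w) + ((v + s) ?k + smax a n (v + s - a)) \<le> smax a ?k (v + w + s) + smax a ?k v"
        using upper[OF w s' order_refl, of "v + s - a"] ge(2)[of "v + w + s"] ge(1)[of v]
        by (simp add: algebra_simps del: smax.simps)
      show "(v + w) ?k + smax a n (v + w - a) + smax a n (v + s) \<le> smax a ?k (v + w + s) + smax a ?k v"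
        using upper[OF s w' order_refl, of "v + w - a"] ge(2)[of "v + w + s"] ge(1)[of v]
        by (simp add: algebra_simps del: smax.simps)
      show "(v + w) ?k + smax a n (v + w - a) + ((v + s) ?k + smax a n (v + s - a))
          \<le> smax a ?k (v + w + s) + smax a ?k v"
        using lower[OF w s, of "v - a"] ge(2)[of "v + w + s"] ge(2)[of v]
        by (simp add: algebra_simps del: smax.simps)
    qed
    moreover have "smax a ?k (v + w + s) + smax a ?k v \<le> smax a ?k (v + w) + smax a ?k (v + s) + W"
      if "\<forall>i\<in>{1..?k}. w i \<le> W" for W
      unfolding smax.simps(2)[of a n "v + w + s"] smax.simps(2)[of a n v]
    proof (rule max_add_max_le)
      have W: "w ?k \<le> W" using that by simp
      show "smax a n (v + w + s) + smax a n v \<le> smax a ?k (v + w) + smax a ?k (v + s) + W"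
        using upper[OF w s W, of v] ge(1)[of "v + w"] ge(1)[of "v + s"] by linarith
      \<comment> \<open>Two squares are glued along the edge from \<open>v + w - a\<close> to
        \<open>v + w + s - a\<close>, which cancels; the error \<open>s ?k\<close> enters the head
        of \<open>v + s\<close>.\<close>
      show "smax a n (v + w + s) + (v ?k + smax a n (v - a)) \<le> smax a ?k (v + w) + smax a ?k (v + s) + W"
        using upper[OF w s W, of "v - a"] upper[OF s a order_refl, of "v + w - a"]
          ge(1)[of "v + w"] ge(2)[of "v + s"]
        by (simp add: algebra_simps del: smax.simps)
      show "(v + w + s) ?k + smax a n (v + w + s - a) + smax a n v
          \<le> smax a ?k (v + w) + smax a ?k (v + s) + W"
        using lower[OF w s', of "v + s - a"] ge(1)[of "v + w"] ge(2)[of "v + s"] W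
        by (simp add: algebra_simps del: smax.simps)
      show "(v + w + s) ?k + smax a n (v + w + s - a) + (v ?k + smax a n (v - a))
          \<le> smax a ?k (v + w) + smax a ?k (v + s) + W"
        using upper[OF w s W, of "v - a"] ge(2)[of "v + w"] ge(2)[of "v + s"]
        by (simp add: algebra_simps del: smax.simps)
    qed
    ultimately show ?case by blast
  qed simp
  then show "smax a n (v + w) + smax a n (v + s) \<le> smax a n (v + w + s) + smax a n v"
    and "\<And>W. 0 \<le> W \<Longrightarrow> \<forall>i\<in>{1..n}. w i \<le> W \<Longrightarrow>
      smax a n (v + w + s) + smax a n v \<le> smax a n (v + w) + smax a n (v + s) + W"
    by blast+
qed

section \<open>The equation for subset maxima\<close>

lemma smax_uKP:
  fixes p q b :: "nat \<Rightarrow> real" and r :: real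
  assumes "0 \<le> r"
    and "mono_on {1..n} p" "\<And>i. i \<in> {1..n} \<Longrightarrow> 0 \<le> p i"
    and "mono_on {1..n} q" "\<And>i. i \<in> {1..n} \<Longrightarrow> 0 \<le> q i"
    and "\<And>i. i \<in> {1..n} \<Longrightarrow> b i = min (q i) r"
  shows "smax (p + q) n (x - q) + smax (p + q) n (x + p - b) =
    max (smax (p + q) n (x + p) + smax (p + q) n (x - q - b) - r)
        (smax (p + q) n (x - b) + smax (p + q) n (x + p - q))"
  using assms(2-)
proof (induction n arbitrary: x)
  case 0
  then show ?case using assms(1) by simp
next
  case (Suc n)
  let ?k = "Suc n" and ?a = "p + q"
  note p = Suc.prems(1,2) and q = Suc.prems(3,4) and b = Suc.prems(5)
  have p_le: "p i \<le> p j" and q_le: "q i \<le> q j" and b_le: "b i \<le> b j"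
    and qb_le: "q i - b i \<le> q j - b j" if "i \<in> {1..?k}" "j \<in> {1..?k}" "i \<le> j" for i j
    using mono_onD[OF p(1) that] mono_onD[OF q(1) that] b that by auto
  have b_bounds: "0 \<le> b i" "b i \<le> q i" "b i \<le> r" if "i \<in> {1..?k}" for i
    using b[OF that] q(2)[OF that] assms(1) by auto
  have adm: "admissible ?k ?a p" "admissible ?k ?a q" "admissible ?k ?a ?a"
      "admissible ?k ?a b" "admissible ?k ?a (p + b)" "admissible ?k ?a (q - b)"
      "admissible ?k ?a (p + q - b)"
    using p(2) q(2) b_bounds p_le q_le b_le qb_le unfolding admissible_def mono_on_def
    by (simp_all add: add_mono add_increasing add_increasing2 del: atLeastAtMost_iff) (smt (verit))+
  show ?case
  proof (cases "q ?k \<le> r")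
    case True
    \<comment> \<open>With \<open>b = q\<close> the second argument of \<open>max\<close> equals the
      left side, so only the first has to be bounded by it.\<close>
    have "b i = q i" if "i \<in> {1..?k}" for i
      using b[OF that] q_le[OF that, of ?k] that True by auto
    then have eq: "smax ?a ?k (x - b) = smax ?a ?k (x - q)" "smax ?a ?k (x + p - b) = smax ?a ?k (x + p - q)"
        "smax ?a ?k (x - q - b) = smax ?a ?k (x - q - q)"
      by (intro smax_cong; simp)+
    have "\<forall>i\<in>{1..?k}. q i \<le> r"
      using q_le[of _ ?k] True by fastforce
    from smax_submodular_upto[OF adm(2,3) assms(1) this, of "x - q - q"]
    have "smax ?a ?k (x + p) + smax ?a ?k (x - q - q) \<le> smax ?a ?k (x - q) + smax ?a ?k (x + p - q) + r"
      by (simp add: algebra_simps del: smax.simps)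
    then show ?thesis unfolding eq by linarith
  next
    case False
    then have bk: "b ?k = r" using b by simp
    have upper: "smax ?a n (v + w + s) + smax ?a n v \<le> smax ?a n (v + w) + smax ?a n (v + s) + w ?k"
      if "admissible ?k ?a w" "admissible ?k ?a s" for v w s
      using that admissible_le_last[of n ?a w]
      by (intro smax_submodular_upto) (auto simp: admissible_def intro: mono_on_subset)
    \<comment> \<open>\<open>D1\<close> to \<open>D4\<close> compare the competing degree 1 terms
      with \<open>smax ?a n (x - q - b) + smax ?a n (x - q)\<close>; the constants are directions
      evaluated at \<open>?k\<close>.\<close>
    have D1: "smax ?a n (x + p - b) + smax ?a n (x - p - q - q) \<le>
        smax ?a n (x - q - b) + smax ?a n (x - q) + (p ?k + q ?k - r)"
      using upper[OF adm(7,3), of "x - p - q - q"] bk by (simp add: algebra_simps)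
    \<comment> \<open>A single square for \<open>D2\<close> would need the direction
      \<open>p + q + b\<close>, which may exceed \<open>?a\<close>; two squares are chained
      instead.\<close>
    have "smax ?a n (x + p - b) + smax ?a n (x - p - q - q - b) \<le>
        smax ?a n (x - q - b) + smax ?a n (x - q - b) + (p ?k + q ?k)"
      using upper[OF adm(3,3), of "x - p - q - q - b"] by (simp add: algebra_simps)
    moreover have "smax ?a n (x + p) + smax ?a n (x - q - b) \<le>
        smax ?a n (x - q) + smax ?a n (x + p - b) + r"
      using upper[OF adm(4,3), of "x - q - b"] bk by (simp add: algebra_simps)
    ultimately have D2: "smax ?a n (x + p) + smax ?a n (x - p - q - q - b) \<le>
        smax ?a n (x - q - b) + smax ?a n (x - q) + (p ?k + q ?k + r)"
      by linarith
    have D3: "smax ?a n (x + p - q) + smax ?a n (x - p - q - b) \<le>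
        smax ?a n (x - q - b) + smax ?a n (x - q) + p ?k"
      using upper[OF adm(1,5), of "x - p - q - b"] by (simp add: algebra_simps)
    have D4: "smax ?a n (x - b) + smax ?a n (x - q - q) \<le>
        smax ?a n (x - q - b) + smax ?a n (x - q) + (q ?k - r)"
      using upper[OF adm(6,2), of "x - q - q"] bk by (simp add: algebra_simps)
    have IH: "smax ?a n (x - q) + smax ?a n (x + p - b) =
      max (smax ?a n (x + p) + smax ?a n (x - q - b) - r) (smax ?a n (x - b) + smax ?a n (x + p - q))" for x
      using Suc.prems by (intro Suc.IH) (auto intro: mono_on_subset)
    \<comment> \<open>Degree 2: the last soliton is present in both factors, which shifts
      \<open>x\<close> by \<open>?a\<close>.\<close>
    have IH': "smax ?a n (x - p - q - q) + smax ?a n (x - q - b) =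
      max (smax ?a n (x - q) + smax ?a n (x - p - q - q - b) - r)
        (smax ?a n (x - p - q - b) + smax ?a n (x - q - q))"
      using IH[of "x - p - q"] by (simp add: algebra_simps)
    have eqs: "x - q - ?a = x - p - q - q" "x + p - b - ?a = x - q - b" "x + p - ?a = x - q"
      "x - q - b - ?a = x - p - q - q - b" "x - b - ?a = x - p - q - b" "x + p - q - ?a = x - q - q"
      by (simp_all add: algebra_simps)
    have at_k: "(x - q) ?k = x ?k - q ?k" "(x + p - b) ?k = x ?k + p ?k - r"
      "(x + p) ?k = x ?k + p ?k" "(x - q - b) ?k = x ?k - q ?k - r"
      "(x - b) ?k = x ?k - r" "(x + p - q) ?k = x ?k + p ?k - q ?k"
      by (simp_all add: bk)
    show ?thesis
      using D1 D2 D3 D4 IH[of x] IH' unfolding smax.simps(2) eqs at_k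
      by (rule max_exchange)
  qed
qed

section \<open>Lattice translations and the return to \<open>T\<close>\<close>

lemma signed_sum_plus_one: "signed_sum 0 (n + 1) f = signed_sum 0 n f + f (n + 1)"
proof -
  consider "n \<ge> 0" | "n = -1" | "n < -1" by linarith
  then show ?thesis
  proof cases
    case 1
    then have "{1..n + 1} = insert (n + 1) {1..n}" by auto
    with 1 show ?thesis by (auto simp: signed_sum_def)
  next
    case 3
    then have "{n + 1..0} = insert (n + 1) {n + 2..0}" by auto
    with 3 show ?thesis by (auto simp: signed_sum_def add.commute)
  qed (simp add: signed_sum_def)
qed

lemma eta_shift:
  "eta C P Q R i (l + 1) m n = eta C P Q R i l m n + P i"
  "eta C P Q R i (l - 1) m n = eta C P Q R i l m n - P i"
  "eta C P Q R i l (m + 1) n = eta C P Q R i l m n - Q i"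
  "eta C P Q R i l m (n + 1) = eta C P Q R i l m n - min (Q i) (R n)"
  unfolding eta_def signed_sum_plus_one by (simp_all add: Omega_def algebra_simps)

text \<open>The move to \<open>(l - 1, m + 1)\<close> lowers \<open>2 * eta\<close> by
  \<open>2 * P + 2 * Q\<close> at every lattice point, so the position enters only through the last
  argument of \<open>smax\<close>.\<close>

lemma T_eq_smax:
  "T C P Q R k l m n = smax ((\<lambda>i. 2 * P i) + (\<lambda>i. 2 * Q i)) k (\<lambda>i. 2 * eta C P Q R i l m n)"
proof (induction k arbitrary: l m)
  case (Suc k)
  have "(\<lambda>i. 2 * eta C P Q R i (l - 1) (m + 1) n) =
      (\<lambda>i. 2 * eta C P Q R i l m n) - ((\<lambda>i. 2 * P i) + (\<lambda>i. 2 * Q i))"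
    by (auto simp: eta_shift)
  with Suc show ?case by (simp add: plus_fun_def)
qed simp

lemma chain_mono_nonneg:
  fixes f :: "nat \<Rightarrow> real"
  assumes "N \<ge> 1 \<Longrightarrow> f 1 \<ge> 0" "\<And>i. 1 \<le> i \<Longrightarrow> i < N \<Longrightarrow> f i \<le> f (i + 1)"
  shows "mono_on {1..N} f" "\<And>i. i \<in> {1..N} \<Longrightarrow> 0 \<le> f i"
proof -
  have *: "f i \<le> f j" if "i \<le> j" "1 \<le> i" "j \<le> N" for i j
    using that
  proof (induction j rule: dec_induct)
    case (step m)
    then show ?case using assms(2)[of m] by simp
  qed simp
  show "mono_on {1..N} f"
    by (rule mono_onI) (simp add: *)
  show "0 \<le> f i" if "i \<in> {1..N}" for i
  proof -
    have "0 \<le> f 1" by (rule assms(1)) (use that in simp)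
    also have "f 1 \<le> f i" using *[of 1 i] that by simp
    finally show ?thesis .
  qed
qed

theorem theorem1:
  fixes R :: "int \<Rightarrow> real" and N :: nat and C P Q :: "nat \<Rightarrow> real"
  assumes "\<And>n. R n \<ge> 0"
    and "N \<ge> 1 \<Longrightarrow> P 1 \<ge> 0"
    and "\<And>i. 1 \<le> i \<Longrightarrow> i < N \<Longrightarrow> P i \<le> P (i + 1)"
    and "N \<ge> 1 \<Longrightarrow> Q 1 \<ge> 0"
    and "\<And>i. 1 \<le> i \<Longrightarrow> i < N \<Longrightarrow> Q i \<le> Q (i + 1)"
  shows "solves_nonautonomous_uKP R (T C P Q R N)"
  unfolding solves_nonautonomous_uKP_def
proof (intro allI)
  fix l m n
  \<comment> \<open>The factor 2 is absorbed here, so that \<open>b\<close> is the minimum of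
    \<open>q\<close> and \<open>r = 2 * R n\<close>.\<close>
  define p q b x where defs: "p = (\<lambda>i. 2 * P i)" "q = (\<lambda>i. 2 * Q i)"
    "b = (\<lambda>i. 2 * min (Q i) (R n))" "x = (\<lambda>i. 2 * eta C P Q R i l m n)"
  note P = chain_mono_nonneg[of N P, OF assms(2,3)] and Q = chain_mono_nonneg[of N Q, OF assms(4,5)]
  have "smax (p + q) N (x - q) + smax (p + q) N (x + p - b) =
    max (smax (p + q) N (x + p) + smax (p + q) N (x - q - b) - 2 * R n)
        (smax (p + q) N (x - b) + smax (p + q) N (x + p - q))"
    using assms(1)[of n] P Q
    by (intro smax_uKP) (auto simp: defs mono_on_def)
  moreover have
    "T C P Q R N l (m + 1) n = smax (p + q) N (x - q)"
    "T C P Q R N (l + 1) m (n + 1) = smax (p + q) N (x + p - b)"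
    "T C P Q R N (l + 1) m n = smax (p + q) N (x + p)"
    "T C P Q R N l (m + 1) (n + 1) = smax (p + q) N (x - q - b)"
    "T C P Q R N l m (n + 1) = smax (p + q) N (x - b)"
    "T C P Q R N (l + 1) (m + 1) n = smax (p + q) N (x + p - q)"
    unfolding T_eq_smax defs
    by (rule arg_cong[where f = "smax _ N"], simp add: fun_eq_iff eta_shift)+
  ultimately show "T C P Q R N l (m + 1) n + T C P Q R N (l + 1) m (n + 1) =
      max (T C P Q R N (l + 1) m n + T C P Q R N l (m + 1) (n + 1) - 2 * R n)
          (T C P Q R N l m (n + 1) + T C P Q R N (l + 1) (m + 1) n)"
    by simp
qed

end
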